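(* Let $\succsim_1$ and $\succsim_2$ be CRDU preference relations on $\mathcal X$ with matching probabilities $\nu_1$ and $\nu_2$ respectively. Then $\succsim_2$ is more ambiguity averse than $\succsim_1$ if and only if $\nu_1(A)\ge\nu_2(A)$ for all $A\in\mathcal F$.
   Context: Setting. $(\Omega,\mathcal F)$ is a measurable space, $\mathcal G\subseteq\mathcal F$ is a sub-$\sigma$-algebra, and $\mathbb P:\mathcal G\to[0,1]$ is a (countably additive) probability measure that is atomless: $\{\mathbb P(B):B\in\mathcal G,\,B\subseteq A\}=[0,\mathbb P(A)]$ for every $A\in\mathcal G$. An act is a bounded $\mathcal F$-measurable function $X:\Omega\to\mathbb R$; $\mathcal X$ is the set of acts. A preference relation $\succsim$ is a total preorder on $\mathcal X$; $\succ$ and $\simeq$ are its strict and symmetric parts. For $A,B\in\mathcal F$, $A\succsim B$ means $\mathbf 1_A\succsim\mathbf 1_B$ (similarly $\simeq$). A capacity is $\nu:\mathcal F\to\mathbb R$ with $\nu(\varnothing)=0$, $\nu(\Omega)=1$, and $\nu(A)\le\nu(B)$ whenever $A\subseteq B$. It is continuous if $\nu(A_n)\to\nu(\bigcup_n A_n)$ for increasing sequences and $\nu(A_n)\to\nu(\bigcap_n A_n)$ for decreasing sequences. It is risk conforming if $\nu|_{\mathcal G}=\mathbb P$. A distortion function is an increasing $g:[0,1]\to[0,1]$ with $g(0)=0$, $g(1)=1$. The Choquet integral is $\int X\,\mathrm d\nu=\int_0^\infty\nu(X>x)\,\mathrm dx+\int_{-\infty}^0(\nu(X>x)-1)\,\mathrm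 dx$. A preference relation $\succsim$ is a CRDU preference relation if there are a continuous strictly increasing $u:\mathbb R\to\mathbb R$, a continuous strictly increasing distortion function $g$, and a continuous risk-conforming capacity $\nu$ such that $X\succsim Y\iff\int u(X)\,\mathrm d(g\circ\nu)\ge\int u(Y)\,\mathrm d(g\circ\nu)$ for all $X,Y\in\mathcal X$. A $\succsim$-matching probability is a function $\nu:\mathcal F\to[0,1]$ such that for every $A\in\mathcal F$ there is $R_A\in\mathcal G$ with $\nu(A)=\mathbb P(R_A)$ and $A\simeq R_A$. For a CRDU preference relation it exists, is unique, and equals the capacity $\nu$ in the representation. $\succsim_2$ is more ambiguity averse than $\succsim_1$ if for all $R\in\mathcal G$ and $A\in\mathcal F$: $R\succsim_1A\implies R\succsim_2A$. *)

theory Defs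
  imports "HOL-Probability.Probability"
begin

text \<open>
  The measurable space \<open>(\<Omega>, \<F>)\<close> is given by \<open>space M\<close> and \<open>sets M\<close>; the measure component of
  \<open>M\<close> plays no role. The sub-\<open>\<sigma>\<close>-algebra \<open>\<G>\<close> and the probability on it are \<open>sets P\<close> and
  \<open>measure P\<close> for a probability space \<open>P\<close> with \<open>subalgebra M P\<close>.
\<close>

definition atomless :: "'a measure \<Rightarrow> bool" where
  "atomless P \<longleftrightarrow>
     (\<forall>A\<in>sets P. {measure P B | B. B \<in> sets P \<and> B \<subseteq> A} = {0..measure P A})"

text \<open>
  Functions are taken extensional on \<open>\<Omega>\<close>, so that acts correspond exactly to functions
  \<open>\<Omega> \<rightarrow> \<real>\<close>, without spurious variation outside \<open>\<Omega>\<close>.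
\<close>

definition acts :: "'a measure \<Rightarrow> ('a \<Rightarrow> real) set" where
  "acts M = {X \<in> borel_measurable M. X \<in> extensional (space M) \<and> bounded (X ` space M)}"

definition ind_act :: "'a measure \<Rightarrow> 'a set \<Rightarrow> 'a \<Rightarrow> real" where
  "ind_act M A = restrict (indicat_real A) (space M)"

text \<open>A pair \<open>(X, Y)\<close> in the relation means that \<open>X\<close> is weakly preferred to \<open>Y\<close>.\<close>

definition preference_relation :: "'a measure \<Rightarrow> ('a \<Rightarrow> real) rel \<Rightarrow> bool" where
  "preference_relation M r \<longleftrightarrow> preorder_on (acts M) r \<and> total_on (acts M) r"

definition weakly_preferred_event :: "'a measure \<Rightarrow> ('a \<Rightarrow> real) rel \<Rightarrow> 'a set \<Rightarrow> 'a set \<Rightarrow> bool" where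
  "weakly_preferred_event M r A B \<longleftrightarrow> (ind_act M A, ind_act M B) \<in> r"

definition indifferent_event :: "'a measure \<Rightarrow> ('a \<Rightarrow> real) rel \<Rightarrow> 'a set \<Rightarrow> 'a set \<Rightarrow> bool" where
  "indifferent_event M r A B \<longleftrightarrow>
     weakly_preferred_event M r A B \<and> weakly_preferred_event M r B A"

definition capacity :: "'a measure \<Rightarrow> ('a set \<Rightarrow> real) \<Rightarrow> bool" where
  "capacity M \<nu> \<longleftrightarrow> \<nu> {} = 0 \<and> \<nu> (space M) = 1 \<and> mono_on (sets M) \<nu>"

definition continuous_capacity :: "'a measure \<Rightarrow> ('a set \<Rightarrow> real) \<Rightarrow> bool" where
  "continuous_capacity M \<nu> \<longleftrightarrow> capacity M \<nu> \<and>
     (\<forall>A :: nat \<Rightarrow> 'a set. range A \<subseteq> sets M \<longrightarrow> incseq A \<longrightarrow>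
        (\<lambda>n. \<nu> (A n)) \<longlonglongrightarrow> \<nu> (\<Union>n. A n)) \<and>
     (\<forall>A :: nat \<Rightarrow> 'a set. range A \<subseteq> sets M \<longrightarrow> decseq A \<longrightarrow>
        (\<lambda>n. \<nu> (A n)) \<longlonglongrightarrow> \<nu> (\<Inter>n. A n))"

definition risk_conforming :: "'a measure \<Rightarrow> ('a set \<Rightarrow> real) \<Rightarrow> bool" where
  "risk_conforming P \<nu> \<longleftrightarrow> (\<forall>A\<in>sets P. \<nu> A = measure P A)"

definition distortion_function :: "(real \<Rightarrow> real) \<Rightarrow> bool" where
  "distortion_function g \<longleftrightarrow>
     g \<in> {0..1} \<rightarrow> {0..1} \<and> mono_on {0..1} g \<and> g 0 = 0 \<and> g 1 = 1"

text \<open>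
  For a capacity and a bounded measurable \<open>X\<close> both integrands are monotone, bounded and vanish
  outside a bounded interval, so the integrals below exist.
\<close>

definition choquet_integral :: "'a measure \<Rightarrow> ('a set \<Rightarrow> real) \<Rightarrow> ('a \<Rightarrow> real) \<Rightarrow> real" where
  "choquet_integral M \<nu> X =
     (LBINT x:{0..}. \<nu> {\<omega> \<in> space M. X \<omega> > x}) +
     (LBINT x:{..0}. (\<nu> {\<omega> \<in> space M. X \<omega> > x} - 1))"

definition CRDU :: "'a measure \<Rightarrow> 'a measure \<Rightarrow> ('a \<Rightarrow> real) rel \<Rightarrow> bool" where
  "CRDU M P r \<longleftrightarrow> preference_relation M r \<and>
     (\<exists>u :: real \<Rightarrow> real. \<exists>g :: real \<Rightarrow> real. \<exists>\<nu> :: 'a set \<Rightarrow> real.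
        continuous_on UNIV u \<and> strict_mono u \<and>
        distortion_function g \<and> continuous_on {0..1} g \<and> strict_mono_on {0..1} g \<and>
        continuous_capacity M \<nu> \<and> risk_conforming P \<nu> \<and>
        (\<forall>X\<in>acts M. \<forall>Y\<in>acts M. (X, Y) \<in> r \<longleftrightarrow>
           choquet_integral M (g \<circ> \<nu>) (\<lambda>\<omega>. u (X \<omega>)) \<ge>
           choquet_integral M (g \<circ> \<nu>) (\<lambda>\<omega>. u (Y \<omega>))))"

definition matching_probability ::
    "'a measure \<Rightarrow> 'a measure \<Rightarrow> ('a \<Rightarrow> real) rel \<Rightarrow> ('a set \<Rightarrow> real) \<Rightarrow> bool" where
  "matching_probability M P r \<nu> \<longleftrightarrow> \<nu> \<in> sets M \<rightarrow> {0..1} \<and>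
     (\<forall>A\<in>sets M. \<exists>R\<in>sets P. \<nu> A = measure P R \<and> indifferent_event M r A R)"

text \<open>The first relation is the more ambiguity averse one.\<close>

definition more_ambiguity_averse ::
    "'a measure \<Rightarrow> 'a measure \<Rightarrow> ('a \<Rightarrow> real) rel \<Rightarrow> ('a \<Rightarrow> real) rel \<Rightarrow> bool" where
  "more_ambiguity_averse M P r2 r1 \<longleftrightarrow>
     (\<forall>R\<in>sets P. \<forall>A\<in>sets M.
        weakly_preferred_event M r1 R A \<longrightarrow> weakly_preferred_event M r2 R A)"

end

theory Submission
  imports Defs
begin

text \<open>
  On indicator acts the Choquet integral of a CRDU representation is
  \<open>u 0 + (u 1 - u 0) * g (\<nu> A)\<close>, so a CRDU preference orders events by \<open>\<nu>\<close>, which extends the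
  objective probability and hence is the matching probability. A risky event \<open>R\<close> is thus
  weakly preferred to \<open>A\<close> exactly when its probability is at least the matching probability
  of \<open>A\<close>; comparing the two thresholds for \<open>A\<close> gives the theorem.
\<close>

text \<open>As a function of \<open>x\<close>, \<open>indicat_real {..<a} x\<close> is the level
  function of the constant \<open>a\<close> under a normalized set function. Its two half-line
  integrals \<open>max 0 a\<close> and \<open>min 0 a\<close> add up to \<open>a\<close>.\<close>

lemma set_integral_step_nonneg:
  fixes a :: real
  shows "set_integrable lborel {0..} (\<lambda>x. indicat_real {..<a} x)"
    and "(LBINT x:{0..}. indicat_real {..<a} x) = max 0 a"
proof -
  have *: "(\<lambda>x. indicat_real {0..} x *\<^sub>R indicat_real {..<a} x) = indicat_real {0..<a}"
    by (auto simp: indicator_def)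
  show "set_integrable lborel {0..} (\<lambda>x. indicat_real {..<a} x)"
    unfolding set_integrable_def *
    by (cases "0 \<le> a") (auto intro!: integrable_real_indicator)
  show "(LBINT x:{0..}. indicat_real {..<a} x) = max 0 a"
    unfolding set_lebesgue_integral_def * by (cases "0 \<le> a") simp_all
qed

lemma set_integral_step_nonpos:
  fixes a :: real
  shows "set_integrable lborel {..0} (\<lambda>x. indicat_real {..<a} x - 1)"
    and "(LBINT x:{..0}. indicat_real {..<a} x - 1) = min 0 a"
proof -
  \<comment> \<open>For \<open>a > 0\<close> the interval \<open>{a..0}\<close> is empty, which
    accounts for the value \<open>0\<close> of \<open>min 0 a\<close>.\<close>
  have *: "(\<lambda>x. indicat_real {..0} x *\<^sub>R (indicat_real {..<a} x - 1)) =
      (\<lambda>x. - indicat_real {a..0} x)"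
    by (rule ext) (auto simp: indicator_def)
  show "set_integrable lborel {..0} (\<lambda>x. indicat_real {..<a} x - 1)"
    unfolding set_integrable_def *
    by (intro integrable_minus integrable_real_indicator) (auto simp: emeasure_lborel_Icc_eq)
  show "(LBINT x:{..0}. indicat_real {..<a} x - 1) = min 0 a"
    unfolding set_lebesgue_integral_def * by simp
qed

text \<open>The level function is a combination of the steps at \<open>b\<close> and
  \<open>a\<close> with weights \<open>\<mu> A\<close> and \<open>1 - \<mu> A\<close>, so the
  integral is the same combination of \<open>b\<close> and \<open>a\<close>.\<close>

lemma choquet_integral_two_valued:
  fixes a b :: real
  assumes "\<mu> {} = 0" "\<mu> (space M) = 1" "A \<subseteq> space M" "a \<le> b"
    and X: "\<And>\<omega>. \<omega> \<in> space M \<Longrightarrow> X \<omega> = (if \<omega> \<in> A then b else a)"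
  shows "choquet_integral M \<mu> X = a + (b - a) * \<mu> A"
proof -
  let ?s = "\<lambda>a x. indicat_real {..<a::real} x"
  have level: "\<mu> {\<omega> \<in> space M. X \<omega> > x} = \<mu> A * ?s b x + (1 - \<mu> A) * ?s a x" for x
  proof -
    have "{\<omega> \<in> space M. X \<omega> > x} = (if x < a then space M else if x < b then A else {})"
      using X assms(3,4) by (auto split: if_splits)
    then show ?thesis
      using assms(1,2,4) by (auto simp: indicator_def)
  qed
  have pos: "(LBINT x:{0..}. \<mu> {\<omega> \<in> space M. X \<omega> > x}) = \<mu> A * max 0 b + (1 - \<mu> A) * max 0 a"
    unfolding level
    by (subst set_integral_add(2))
       (auto intro!: set_integrable_mult_right simp: set_integral_step_nonneg)
  \<comment> \<open>The weights sum to 1, so the subtracted 1 can be split between the steps; each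
    step minus 1 is integrable on \<open>{..0}\<close>, whereas the step itself is not.\<close>
  have level': "\<mu> {\<omega> \<in> space M. X \<omega> > x} - 1 =
      \<mu> A * (?s b x - 1) + (1 - \<mu> A) * (?s a x - 1)" for x
    unfolding level by (simp add: algebra_simps)
  have neg: "(LBINT x:{..0}. \<mu> {\<omega> \<in> space M. X \<omega> > x} - 1) = \<mu> A * min 0 b + (1 - \<mu> A) * min 0 a"
    unfolding level'
    by (subst set_integral_add(2))
       (auto intro!: set_integrable_mult_right simp: set_integral_step_nonpos)
  show ?thesis
    unfolding choquet_integral_def pos neg by (auto simp: max_def min_def algebra_simps)
qed

lemma ind_act_in_acts:
  assumes "A \<in> sets M"
  shows "ind_act M A \<in> acts M"
proof -
  have "ind_act M A \<in> borel_measurable M"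
    unfolding ind_act_def using assms by (subst measurable_cong[where g = "indicat_real A"]) auto
  moreover have "ind_act M A ` space M \<subseteq> {0, 1}"
    by (auto simp: ind_act_def indicator_def)
  then have "bounded (ind_act M A ` space M)"
    by (rule bounded_subset[rotated]) simp
  ultimately show ?thesis
    by (simp add: acts_def ind_act_def)
qed

lemma capacity_in_unit_interval:
  assumes "capacity M \<nu>" "A \<in> sets M"
  shows "\<nu> A \<in> {0..1}"
  using assms mono_onD[of "sets M" \<nu> "{}" A] mono_onD[of "sets M" \<nu> A "space M"]
    sets.sets_into_space[of A M]
  by (auto simp: capacity_def)

text \<open>Since \<open>u 0 < u 1\<close> and \<open>g\<close> is strictly increasing, both cancel
  from the comparison of indicator acts, leaving only the order given by
  \<open>\<nu>\<close>.\<close>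

lemma CRDU_event_order:
  assumes "CRDU M P r"
  obtains \<nu> where "risk_conforming P \<nu>"
    and "\<And>A B. \<lbrakk>A \<in> sets M; B \<in> sets M\<rbrakk> \<Longrightarrow> weakly_preferred_event M r A B \<longleftrightarrow> \<nu> B \<le> \<nu> A"
proof -
  obtain u g :: "real \<Rightarrow> real" and \<nu> where u: "strict_mono u"
    and g: "distortion_function g" "strict_mono_on {0..1} g"
    and \<nu>: "continuous_capacity M \<nu>" "risk_conforming P \<nu>"
    and rep: "\<forall>X\<in>acts M. \<forall>Y\<in>acts M. (X, Y) \<in> r \<longleftrightarrow>
           choquet_integral M (g \<circ> \<nu>) (\<lambda>\<omega>. u (X \<omega>)) \<ge>
           choquet_integral M (g \<circ> \<nu>) (\<lambda>\<omega>. u (Y \<omega>))"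
    using assms unfolding CRDU_def by blast
  have cap: "capacity M \<nu>"
    using \<nu>(1) by (simp add: continuous_capacity_def)
  have u01: "u 0 < u 1"
    using u by (simp add: strict_mono_less)
  have value_ind: "choquet_integral M (g \<circ> \<nu>) (\<lambda>\<omega>. u (ind_act M A \<omega>)) =
      u 0 + (u 1 - u 0) * g (\<nu> A)" if "A \<in> sets M" for A
    using cap g(1) u01 sets.sets_into_space[OF that]
    by (subst choquet_integral_two_valued[where A = A and a = "u 0" and b = "u 1"])
       (auto simp: capacity_def distortion_function_def ind_act_def indicator_def)
  have "weakly_preferred_event M r A B \<longleftrightarrow> \<nu> B \<le> \<nu> A"
    if AB: "A \<in> sets M" "B \<in> sets M" for A B
  proof -
    have "weakly_preferred_event M r A B \<longleftrightarrow> g (\<nu> B) \<le> g (\<nu> A)"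
      using rep AB u01 by (simp add: weakly_preferred_event_def ind_act_in_acts value_ind)
    \<comment> \<open>Strict monotonicity of \<open>g\<close> is known only on
      \<open>{0..1}\<close>, so the values of \<open>\<nu>\<close> must be placed there
      first.\<close>
    also have "\<dots> \<longleftrightarrow> \<nu> B \<le> \<nu> A"
      using strict_mono_on_less_eq[OF g(2)] capacity_in_unit_interval[OF cap] AB by blast
    finally show ?thesis .
  qed
  with \<nu>(2) that show thesis by blast
qed

text \<open>The risky event \<open>S\<close> matched to \<open>A\<close> yields
  \<open>\<nu> A = \<nu> S = measure P S = \<mu> A\<close>, and \<open>\<nu> R = measure P R\<close>
  by risk conformity.\<close>

lemma risk_preferred_iff_matching_probability_le:
  assumes "subalgebra M P" "CRDU M P r" "matching_probability M P r \<mu>"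
    and "R \<in> sets P" "A \<in> sets M"
  shows "weakly_preferred_event M r R A \<longleftrightarrow> \<mu> A \<le> measure P R"
proof -
  obtain \<nu> where conf: "risk_conforming P \<nu>"
    and order: "\<And>A B. \<lbrakk>A \<in> sets M; B \<in> sets M\<rbrakk> \<Longrightarrow> weakly_preferred_event M r A B \<longleftrightarrow> \<nu> B \<le> \<nu> A"
    using CRDU_event_order[OF assms(2)] by blast
  have sub: "sets P \<subseteq> sets M"
    using assms(1) by (simp add: subalgebra_def)
  obtain S where S: "S \<in> sets P" "\<mu> A = measure P S" "indifferent_event M r A S"
    using assms(3,5) by (auto simp: matching_probability_def)
  have "\<nu> A = \<nu> S"
    using S sub assms(5) order by (auto simp: indifferent_event_def intro: antisym)
  then have "\<mu> A = \<nu> A"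
    using conf S by (simp add: risk_conforming_def)
  then show ?thesis
    using order[of R A] assms(4,5) sub conf by (auto simp: risk_conforming_def)
qed

theorem theorem2:
  fixes M P :: "'a measure"
    and r1 r2 :: "('a \<Rightarrow> real) rel"
    and \<nu>1 \<nu>2 :: "'a set \<Rightarrow> real"
  assumes "prob_space P" and "subalgebra M P" and "atomless P"
    and "CRDU M P r1" and "CRDU M P r2"
    and "matching_probability M P r1 \<nu>1" and "matching_probability M P r2 \<nu>2"
  shows "more_ambiguity_averse M P r2 r1 \<longleftrightarrow> (\<forall>A\<in>sets M. \<nu>1 A \<ge> \<nu>2 A)"
proof -
  note pref1 = risk_preferred_iff_matching_probability_le[OF assms(2,4,6)]
    and pref2 = risk_preferred_iff_matching_probability_le[OF assms(2,5,7)]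
  have "more_ambiguity_averse M P r2 r1 \<longleftrightarrow>
      (\<forall>A\<in>sets M. \<forall>R\<in>sets P. \<nu>1 A \<le> measure P R \<longrightarrow> \<nu>2 A \<le> measure P R)"
    unfolding more_ambiguity_averse_def using pref1 pref2 by blast
  \<comment> \<open>From left to right, take for \<open>R\<close> the event matched to
    \<open>A\<close> under \<open>r1\<close>, whose probability is exactly \<open>\<nu>1 A\<close>;
    the converse is transitivity.\<close>
  also have "\<dots> \<longleftrightarrow> (\<forall>A\<in>sets M. \<nu>1 A \<ge> \<nu>2 A)"
    using assms(6) unfolding matching_probability_def by (metis order.refl order.trans)
  finally show ?thesis .
qed

end
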